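(* Let $\mathcal H$ be a separable complex Hilbert space. Let $\mathbf J\in\mathcal B(\mathcal H)$ be skew-adjoint and $\mathbf R\in\mathcal B(\mathcal H)$ be self-adjoint with $\mathbf R\ge0$ and $\dim\ker\mathbf R<\infty$. Then the following conditions are equivalent: (B1) There exists $m\in\mathbb N_0$ such that $\overline{\operatorname{span}}\big(\bigcup_{j=0}^m\operatorname{im}(\mathbf J^j\sqrt{\mathbf R})\big)=\mathcal H$. (B2) There exists $m\in\mathbb N_0$ such that $\bigcap_{j=0}^m\ker(\sqrt{\mathbf R}(\mathbf J^* )^j)=\{0\}$. (B3) There exists $m\in\mathbb N_0$ such that for all $x\in\mathcal H\setminus\{0\}$ there is $j=j(x)\in\{0,\dots,m\}$ with $\langle\mathbf J^j\mathbf R(\mathbf J^* )^jx,x\rangle>0$ (that is, $\sum_{j=0}^m\mathbf J^j\mathbf R(\mathbf J^* )^j>0$). (B4) If a closed subspace $V$ of $\ker\mathbf R$ is invariant under $\mathbf J$, then $V=\{0\}$. (B5) No eigenvector of $\mathbf J$ lies in the kernel of $\mathbf R$. If one of (B1)–(B3) holds for a particular $m$, all of them hold for the same $m$. Moreover, these conditions then also hold for all $m'>m$, and the minimum of all $m$ such that (B1)–(B3) hold is less than or equal to $\dim\ker\mathbf R$.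
   Context: $\mathcal B(\mathcal H)$ is the space of bounded linear operators on $\mathcal H$; $\overline{\operatorname{span}}$ is the closed linear span; $\sqrt{\mathbf R}$ is the unique nonnegative self-adjoint square root of $\mathbf R$. A self-adjoint operator $\mathbf A$ satisfies $\mathbf A>0$ if $\langle\mathbf Ax,x\rangle>0$ for all $x\in\mathcal H\setminus\{0\}$. Skew-adjoint means $\mathbf J^*=-\mathbf J$. *)

theory Defs
  imports "HOL-Analysis.Analysis"
begin

text \<open>
  The norm, metric and topology, and the real vector space structure, are those of the class
  \<^class>\<open>real_inner\<close>. The last axiom says that the real inner product is the real part of the
  complex one, so that \<open>\<parallel>x\<parallel>\<^sup>2 = \<langle>x, x\<rangle>\<close>. The inner product is linear in its first argument.
\<close>

class complex_inner = real_inner +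
  fixes scaleC :: "complex \<Rightarrow> 'a \<Rightarrow> 'a" (infixr \<open>*\<^sub>C\<close> 75)
    and cinner :: "'a \<Rightarrow> 'a \<Rightarrow> complex"
  assumes scaleC_add_right: "a *\<^sub>C (x + y) = a *\<^sub>C x + a *\<^sub>C y"
    and scaleC_add_left: "(a + b) *\<^sub>C x = a *\<^sub>C x + b *\<^sub>C x"
    and scaleC_scaleC: "a *\<^sub>C (b *\<^sub>C x) = (a * b) *\<^sub>C x"
    and scaleR_scaleC: "r *\<^sub>R x = complex_of_real r *\<^sub>C x"
    and cinner_commute: "cinner x y = cnj (cinner y x)"
    and cinner_add_left: "cinner (x + y) z = cinner x z + cinner y z"
    and cinner_scaleC_left: "cinner (a *\<^sub>C x) y = a * cinner x y"
    and inner_eq_Re_cinner: "inner x y = Re (cinner x y)"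

class complex_hilbert = complex_inner + complete_space

global_interpretation complex_vector: vector_space "scaleC :: complex \<Rightarrow> 'a \<Rightarrow> 'a::complex_inner"
proof
  fix a b :: complex and x y :: 'a
  show "a *\<^sub>C (x + y) = a *\<^sub>C x + a *\<^sub>C y" by (rule scaleC_add_right)
  show "(a + b) *\<^sub>C x = a *\<^sub>C x + b *\<^sub>C x" by (rule scaleC_add_left)
  show "a *\<^sub>C (b *\<^sub>C x) = (a * b) *\<^sub>C x" by (rule scaleC_scaleC)
  show "1 *\<^sub>C x = x" using scaleR_scaleC [of 1 x] by simp
qed

instantiation complex :: complex_hilbert
begin

definition scaleC_complex :: "complex \<Rightarrow> complex \<Rightarrow> complex"
  where "scaleC_complex a x = a * x"

definition cinner_complex :: "complex \<Rightarrow> complex \<Rightarrow> complex"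
  where "cinner_complex x y = x * cnj y"

instance
  by standard (simp_all add: scaleC_complex_def cinner_complex_def algebra_simps
      scaleR_conv_of_real inner_complex_def)

end

definition bounded_clinear :: "('a::complex_inner \<Rightarrow> 'b::complex_inner) \<Rightarrow> bool"
  where "bounded_clinear A \<longleftrightarrow> bounded_linear A \<and> (\<forall>c x. A (c *\<^sub>C x) = c *\<^sub>C A x)"

text \<open>
  On a Hilbert space the adjoint of a bounded operator exists by the Riesz representation theorem,
  and is unique.
\<close>

definition cadjoint :: "('a::complex_inner \<Rightarrow> 'a) \<Rightarrow> 'a \<Rightarrow> 'a"
  where "cadjoint A = (THE B. \<forall>x y. cinner (A x) y = cinner x (B y))"

definition self_adjoint :: "('a::complex_inner \<Rightarrow> 'a) \<Rightarrow> bool"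
  where "self_adjoint A \<longleftrightarrow> bounded_clinear A \<and> cadjoint A = A"

definition skew_adjoint :: "('a::complex_inner \<Rightarrow> 'a) \<Rightarrow> bool"
  where "skew_adjoint A \<longleftrightarrow> bounded_clinear A \<and> cadjoint A = (\<lambda>x. - A x)"

text \<open>
  The order on \<^typ>\<open>complex\<close> is the one of \<^theory>\<open>HOL-Library.Complex_Order\<close>: \<open>0 \<le> z\<close> and
  \<open>0 < z\<close> include that \<open>z\<close> is real.
\<close>

definition nonneg_op :: "('a::complex_inner \<Rightarrow> 'a) \<Rightarrow> bool"
  where "nonneg_op A \<longleftrightarrow> self_adjoint A \<and> (\<forall>x. 0 \<le> cinner (A x) x)"

definition pos_op :: "('a::complex_inner \<Rightarrow> 'a) \<Rightarrow> bool"
  where "pos_op A \<longleftrightarrow> self_adjoint A \<and> (\<forall>x. x \<noteq> 0 \<longrightarrow> 0 < cinner (A x) x)"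

definition op_sqrt :: "('a::complex_inner \<Rightarrow> 'a) \<Rightarrow> 'a \<Rightarrow> 'a"
  where "op_sqrt A = (THE S. nonneg_op S \<and> S \<circ> S = A)"

definition op_kernel :: "('a::complex_inner \<Rightarrow> 'b::complex_inner) \<Rightarrow> 'a set"
  where "op_kernel A = {x. A x = 0}"

text \<open>
  Needed because \<^const>\<open>complex_vector.dim\<close> is \<open>0\<close> on infinite-dimensional subspaces.
\<close>

definition finite_cdim :: "'a::complex_inner set \<Rightarrow> bool"
  where "finite_cdim V \<longleftrightarrow> (\<exists>B. finite B \<and> complex_vector.span B = V)"

definition ceigenvector :: "('a::complex_inner \<Rightarrow> 'a) \<Rightarrow> 'a \<Rightarrow> bool"
  where "ceigenvector A v \<longleftrightarrow> v \<noteq> 0 \<and> (\<exists>c. A v = c *\<^sub>C v)"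

definition B1 :: "('a::complex_inner \<Rightarrow> 'a) \<Rightarrow> ('a \<Rightarrow> 'a) \<Rightarrow> nat \<Rightarrow> bool"
  where "B1 J R m \<longleftrightarrow>
    closure (complex_vector.span (\<Union>j\<in>{0..m}. range ((J ^^ j) \<circ> op_sqrt R))) = UNIV"

definition B2 :: "('a::complex_inner \<Rightarrow> 'a) \<Rightarrow> ('a \<Rightarrow> 'a) \<Rightarrow> nat \<Rightarrow> bool"
  where "B2 J R m \<longleftrightarrow> (\<Inter>j\<in>{0..m}. op_kernel (op_sqrt R \<circ> (cadjoint J ^^ j))) = {0}"

definition B3 :: "('a::complex_inner \<Rightarrow> 'a) \<Rightarrow> ('a \<Rightarrow> 'a) \<Rightarrow> nat \<Rightarrow> bool"
  where "B3 J R m \<longleftrightarrow>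
    (\<forall>x. x \<noteq> 0 \<longrightarrow> (\<exists>j\<in>{0..m}. 0 < cinner (((J ^^ j) \<circ> R \<circ> (cadjoint J ^^ j)) x) x))"

definition B3_sum :: "('a::complex_inner \<Rightarrow> 'a) \<Rightarrow> ('a \<Rightarrow> 'a) \<Rightarrow> nat \<Rightarrow> bool"
  where "B3_sum J R m \<longleftrightarrow>
    pos_op (\<lambda>x. \<Sum>j=0..m. ((J ^^ j) \<circ> R \<circ> (cadjoint J ^^ j)) x)"

definition B4 :: "('a::complex_inner \<Rightarrow> 'a) \<Rightarrow> ('a \<Rightarrow> 'a) \<Rightarrow> bool"
  where "B4 J R \<longleftrightarrow>
    (\<forall>V. complex_vector.subspace V \<and> closed V \<and> V \<subseteq> op_kernel R \<and> J ` V \<subseteq> V \<longrightarrow> V = {0})"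

definition B5 :: "('a::complex_inner \<Rightarrow> 'a) \<Rightarrow> ('a \<Rightarrow> 'a) \<Rightarrow> bool"
  where "B5 J R \<longleftrightarrow> \<not> (\<exists>v. ceigenvector J v \<and> v \<in> op_kernel R)"

end

theory Submission
  imports Defs "HOL-Computational_Algebra.Fundamental_Theorem_Algebra"
begin

text \<open>
  Write \<open>N m\<close> for the set of all \<open>x\<close> with \<open>R (J\<^sup>j x) = 0\<close> for every \<open>j \<le> m\<close>; this is the kernel of the
  observability map of order \<open>m\<close> of the pair \<open>(J, R)\<close>. All conditions say that \<open>N m\<close> is zero:
  \<^const>\<open>B1\<close> to \<^const>\<open>B3\<close> for the given \<open>m\<close>, \<^const>\<open>B4\<close> and \<^const>\<open>B5\<close> for some \<open>m\<close>.

  For a fixed \<open>m\<close> this is a matter of rewriting. Since \<open>\<langle>R y, y\<rangle> = \<parallel>sqrt R y\<parallel>\<^sup>2\<close>, the operators \<open>R\<close> and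
  \<open>sqrt R\<close> have the same kernel, and since \<open>J\<^sup>* = - J\<close>, the powers of \<open>J\<^sup>*\<close> and \<open>J\<close> differ by a sign
  only; so \<^const>\<open>B2\<close> means \<open>N m = {0}\<close> (\<open>B2_iff_unobservable\<close>). The same formula, applied to
  \<open>y = (J\<^sup>*)\<^sup>j x\<close>, turns the quadratic forms in \<^const>\<open>B3\<close> and \<^const>\<open>B3_sum\<close> into squares of norms. And
  \<^const>\<open>B1\<close> is dual to \<^const>\<open>B2\<close>: a span is dense if and only if its orthogonal complement is zero
  (\<open>closure_span_eq_UNIV_iff\<close>), and the orthogonal complement of the range of \<open>J\<^sup>j sqrt R\<close> is the
  kernel of \<open>sqrt R (J\<^sup>*)\<^sup>j\<close>.

  For the conditions without \<open>m\<close>: a subspace of \<open>ker R\<close> that is invariant under \<open>J\<close> lies in every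
  \<open>N m\<close>, which gives \<^const>\<open>B4\<close>, and an eigenvector of \<open>J\<close> in \<open>ker R\<close> would lie in a closed
  subspace of this kind, so that \<^const>\<open>B4\<close> gives \<^const>\<open>B5\<close>. Conversely, the subspaces \<open>N m\<close> decrease, starting from \<open>N 0 = ker R\<close>.
  If two consecutive ones agree, they are invariant under \<open>J\<close>; being of finite dimension over the
  complex numbers, they are zero or contain an eigenvector. Under \<^const>\<open>B5\<close> the dimension
  therefore drops in each step until it is zero, which takes at most \<open>dim (ker R)\<close> steps
  (\<open>unobservable_eq_0\<close>).

  This needs some operator theory: the projection theorem, from which the existence of adjoints
  and the density criterion follow, and the existence and uniqueness of the nonnegative square
  root. The root is obtained as a limit of polynomials in the operator, so that it commutes with
  everything that commutes with the operator; the uniqueness rests on this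
  (\<open>nonneg_op_sqrt_exists\<close>, \<open>nonneg_op_sqrt_unique\<close>).
\<close>


section \<open>The complex inner product and its real part\<close>

lemma cinner_add_right: "cinner x (y + z) = cinner x y + cinner x z"
  by (metis cinner_commute cinner_add_left complex_cnj_add)

lemma cinner_scaleC_right: "cinner x (a *\<^sub>C y) = cnj a * cinner x y"
  by (metis cinner_commute cinner_scaleC_left complex_cnj_mult)

lemma cinner_minus_left: "cinner (- x) y = - cinner x y"
  using cinner_scaleC_left [of "-1" x y] by simp

lemma cinner_minus_right: "cinner x (- y) = - cinner x y"
  using cinner_scaleC_right [of x "-1" y] by simp

lemma cinner_zero_left [simp]: "cinner 0 y = 0"
  using cinner_scaleC_left [of 0 0 y] by simp

lemma cinner_zero_right [simp]: "cinner x 0 = 0"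
  using cinner_scaleC_right [of x 0 0] by simp

lemma cinner_diff_left: "cinner (x - y) z = cinner x z - cinner y z"
  using cinner_add_left [of x "- y" z] by (simp add: cinner_minus_left)

lemma cinner_diff_right: "cinner x (y - z) = cinner x y - cinner x z"
  using cinner_add_right [of x y "- z"] by (simp add: cinner_minus_right)

lemma cinner_sum_left: "cinner (\<Sum>i\<in>I. f i) y = (\<Sum>i\<in>I. cinner (f i) y)"
  by (induction I rule: infinite_finite_induct) (auto simp: cinner_add_left)

lemma cinner_sum_right: "cinner x (\<Sum>i\<in>I. f i) = (\<Sum>i\<in>I. cinner x (f i))"
  by (induction I rule: infinite_finite_induct) (auto simp: cinner_add_right)

lemma cinner_self: "cinner x x = complex_of_real ((norm x)\<^sup>2)"
proof -
  have "Im (cinner x x) = 0"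
    using cinner_commute [of x x] by (metis Reals_cnj_iff complex_is_Real_iff)
  moreover have "Re (cinner x x) = (norm x)\<^sup>2"
    by (simp add: inner_eq_Re_cinner [symmetric] power2_norm_eq_inner)
  ultimately show ?thesis
    by (simp add: complex_eq_iff)
qed

lemma cinner_eq_Complex_inner: "cinner x y = Complex (inner x y) (inner x (\<i> *\<^sub>C y))"
  by (simp add: complex_eq_iff inner_eq_Re_cinner cinner_scaleC_right)

lemma cinner_eqI:
  assumes "\<And>z. cinner z x = cinner z y"
  shows "x = y"
proof -
  have "cinner (x - y) (x - y) = 0"
    by (simp add: cinner_diff_right assms)
  then show ?thesis
    by (simp add: cinner_self)
qed

lemma cinner_all_eq_0_iff: "(\<forall>x. cinner x y = 0) \<longleftrightarrow> y = 0"
  using cinner_self [of y] by auto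

lemma norm_scaleC: "norm (c *\<^sub>C x) = cmod c * norm x"
proof -
  have "cinner (c *\<^sub>C x) (c *\<^sub>C x) = (c * cnj c) * cinner x x"
    by (simp add: cinner_scaleC_left cinner_scaleC_right)
  then have "complex_of_real ((norm (c *\<^sub>C x))\<^sup>2) = complex_of_real ((cmod c * norm x)\<^sup>2)"
    by (simp only: cinner_self complex_norm_square [symmetric] of_real_mult [symmetric]
        power_mult_distrib)
  then have "(norm (c *\<^sub>C x))\<^sup>2 = (cmod c * norm x)\<^sup>2"
    by (simp only: of_real_eq_iff)
  then show ?thesis
    by (rule power2_eq_imp_eq) simp_all
qed

section \<open>Bounded complex-linear operators\<close>

lemma bounded_clinear_bounded_linear: "bounded_clinear A \<Longrightarrow> bounded_linear A"
  by (simp add: bounded_clinear_def)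

lemma bounded_clinear_scaleC: "bounded_clinear A \<Longrightarrow> A (c *\<^sub>C x) = c *\<^sub>C A x"
  by (simp add: bounded_clinear_def)

lemma bounded_clinearI:
  assumes "bounded_linear A" "\<And>c x. A (c *\<^sub>C x) = c *\<^sub>C A x"
  shows "bounded_clinear A"
  using assms by (simp add: bounded_clinear_def)

lemma bounded_clinear_add: "bounded_clinear A \<Longrightarrow> A (x + y) = A x + A y"
  by (simp add: bounded_clinear_def bounded_linear.axioms linear_add bounded_linear.linear)

lemma bounded_clinear_diff: "bounded_clinear A \<Longrightarrow> A (x - y) = A x - A y"
  by (simp add: bounded_clinear_def bounded_linear.linear linear_diff)

lemma bounded_clinear_zero: "bounded_clinear A \<Longrightarrow> A 0 = 0"
  by (simp add: bounded_clinear_def bounded_linear.linear linear_0)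

lemma bounded_clinear_scaleR: "bounded_clinear A \<Longrightarrow> A (r *\<^sub>R x) = r *\<^sub>R A x"
  by (simp add: scaleR_scaleC bounded_clinear_scaleC)

lemma bounded_linear_scaleC: "bounded_linear (\<lambda>x. c *\<^sub>C (x :: 'a::complex_inner))"
  by (rule bounded_linear_intro [where K = "cmod c"])
     (simp_all add: scaleC_add_right scaleR_scaleC scaleC_scaleC norm_scaleC mult.commute)

lemma bounded_clinear_ident: "bounded_clinear (\<lambda>x. x)"
  by (simp add: bounded_clinear_def bounded_linear_ident)

lemma bounded_clinear_const_zero: "bounded_clinear (\<lambda>x. 0)"
  by (simp add: bounded_clinear_def bounded_linear_zero)

lemma bounded_clinear_plus:
  "bounded_clinear A \<Longrightarrow> bounded_clinear B \<Longrightarrow> bounded_clinear (\<lambda>x. A x + B x)"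
  by (simp add: bounded_clinear_def bounded_linear_add scaleC_add_right)

lemma bounded_clinear_uminus: "bounded_clinear A \<Longrightarrow> bounded_clinear (\<lambda>x. - A x)"
  by (simp add: bounded_clinear_def bounded_linear_minus complex_vector.scale_minus_right)

lemma bounded_clinear_minus_op:
  "bounded_clinear A \<Longrightarrow> bounded_clinear B \<Longrightarrow> bounded_clinear (\<lambda>x. A x - B x)"
  by (simp add: bounded_clinear_def bounded_linear_sub complex_vector.scale_right_diff_distrib)

lemma bounded_clinear_scaleC_op: "bounded_clinear A \<Longrightarrow> bounded_clinear (\<lambda>x. c *\<^sub>C A x)"
  by (auto simp: bounded_clinear_def scaleC_scaleC mult.commute
      intro: bounded_linear_compose [OF bounded_linear_scaleC])

lemma bounded_clinear_scaleR_op: "bounded_clinear A \<Longrightarrow> bounded_clinear (\<lambda>x. r *\<^sub>R A x)"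
  unfolding scaleR_scaleC by (rule bounded_clinear_scaleC_op)

lemma bounded_clinear_compose:
  "bounded_clinear A \<Longrightarrow> bounded_clinear B \<Longrightarrow> bounded_clinear (\<lambda>x. A (B x))"
  by (auto simp: bounded_clinear_def intro: bounded_linear_compose)

lemma bounded_clinear_sum:
  "(\<And>i. i \<in> I \<Longrightarrow> bounded_clinear (A i)) \<Longrightarrow> bounded_clinear (\<lambda>x. \<Sum>i\<in>I. A i x)"
  by (induction I rule: infinite_finite_induct)
     (auto intro: bounded_clinear_plus bounded_clinear_const_zero)

lemma bounded_clinear_funpow:
  fixes A :: "'a::complex_inner \<Rightarrow> 'a"
  shows "bounded_clinear A \<Longrightarrow> bounded_clinear (A ^^ j)"
  by (induction j)
     (simp_all add: id_def o_def bounded_clinear_ident bounded_clinear_compose)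

section \<open>Orthogonal projections, and existence of adjoints\<close>

text \<open>
  The points of \<open>V\<close> that minimise the distance to \<open>x\<close> up to \<open>1 / (n + 1)\<close> form nested closed sets,
  and the parallelogram law makes their diameters tend to \<open>0\<close>. So completeness provides a nearest
  point, and the difference to a nearest point is orthogonal to \<open>V\<close>.
\<close>

lemma orthogonal_decomposition:
  fixes V :: "'a::{real_inner, complete_space} set"
  assumes V: "subspace V" and cl: "closed V"
  obtains p where "p \<in> V" "\<And>v. v \<in> V \<Longrightarrow> inner (x - p) v = 0"
proof -
  define d where "d = (INF v\<in>V. (norm (x - v))\<^sup>2)"
  define S where "S n = {v \<in> V. (norm (x - v))\<^sup>2 \<le> d + 1 / (real n + 1)}" for n :: nat
  have bdd: "bdd_below ((\<lambda>v. (norm (x - v))\<^sup>2) ` V)"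
    by (intro bdd_belowI2 [where m = 0]) simp
  have d_le: "d \<le> (norm (x - v))\<^sup>2" if "v \<in> V" for v
    unfolding d_def using bdd that by (rule cINF_lower)
  have V0: "V \<noteq> {}"
    using subspace_0 [OF V] by auto
  have parallelogram: "(dist u v)\<^sup>2 \<le> 4 / (real n + 1)" if "u \<in> S n" "v \<in> S n" for u v n
  proof -
    have uv: "u \<in> V" "v \<in> V"
      using that by (auto simp: S_def)
    then have mid: "(1/2) *\<^sub>R (u + v) \<in> V"
      by (intro subspace_scale [OF V] subspace_add [OF V])
    have "(dist u v)\<^sup>2 = 2 * (norm (x - u))\<^sup>2 + 2 * (norm (x - v))\<^sup>2
        - 4 * (norm (x - (1/2) *\<^sub>R (u + v)))\<^sup>2"
      by (simp add: dist_norm power2_norm_eq_inner inner_diff_left inner_diff_right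
          inner_add_left inner_add_right inner_commute algebra_simps)
    then show ?thesis
      using d_le [OF mid] that by (simp add: S_def)
  qed
  have nonempty: "S n \<noteq> {}" for n
  proof -
    have "\<exists>v\<in>V. (norm (x - v))\<^sup>2 < d + 1 / (real n + 1)"
      using cINF_less_iff [OF V0 bdd, of "d + 1 / (real n + 1)"] unfolding d_def by simp
    then show ?thesis
      by (auto simp: S_def intro: less_imp_le)
  qed
  obtain p where p: "\<And>n. p \<in> S n"
  proof (rule decreasing_closed_nest [of S])
    have "closed ({v. (norm (x - v))\<^sup>2 \<le> d + 1 / (real n + 1)} \<inter> V)" for n
      by (intro closed_Int cl closed_Collect_le continuous_intros)
    then show "closed (S n)" for n
      by (simp add: S_def Int_def conj_commute)
    show "S n \<noteq> {}" for n
      by (rule nonempty)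
    show "S n \<subseteq> S m" if "m \<le> n" for m n
    proof -
      have "1 / (real n + 1) \<le> 1 / (real m + 1)"
        using that by (simp add: frac_le)
      then show ?thesis
        by (fastforce simp: S_def)
    qed
    show "\<exists>n. \<forall>u\<in>S n. \<forall>v\<in>S n. dist u v < e" if "e > 0" for e
    proof -
      obtain n where n: "4 / e\<^sup>2 < real n"
        using reals_Archimedean2 by blast
      have "4 / (real n + 1) < e\<^sup>2"
      proof -
        have "4 < real n * e\<^sup>2" using n that by (simp add: field_simps)
        then have "4 < (real n + 1) * e\<^sup>2" using that by (simp add: algebra_simps add_strict_increasing2)
        then show ?thesis by (simp add: field_simps)
      qed
      then have "(dist u v)\<^sup>2 < e\<^sup>2" if "u \<in> S n" "v \<in> S n" for u v
        using parallelogram [OF that] by linarith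
      then show ?thesis
        using that by (metis less_imp_le power_less_imp_less_base)
    qed
  qed blast
  have pV: "p \<in> V"
    using p by (simp add: S_def)
  have min: "(norm (x - p))\<^sup>2 \<le> d"
  proof (rule field_le_epsilon)
    fix e :: real assume "e > 0"
    then obtain n where "inverse (real (Suc n)) < e"
      using reals_Archimedean by blast
    then show "(norm (x - p))\<^sup>2 \<le> d + e"
      using p [of n] by (simp add: S_def inverse_eq_divide add.commute)
  qed
  have "inner (x - p) v = 0" if v: "v \<in> V" for v
  proof (cases "v = 0")
    case False
    \<comment> \<open>the scalar for which \<open>p + t v\<close> is closest to \<open>x\<close>\<close>
    define t where "t = inner (x - p) v / inner v v"
    have "p + t *\<^sub>R v \<in> V"
      using pV v by (intro subspace_add [OF V] subspace_scale [OF V])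
    then have "(norm (x - p))\<^sup>2 \<le> (norm (x - (p + t *\<^sub>R v)))\<^sup>2"
      using min d_le by (meson order_trans)
    also have "\<dots> = (norm (x - p))\<^sup>2 - 2 * t * inner (x - p) v + t\<^sup>2 * inner v v"
      unfolding power2_norm_eq_inner
      by (simp add: inner_diff_left inner_diff_right inner_add_left inner_add_right inner_commute
          power2_eq_square algebra_simps)
    also have "\<dots> = (norm (x - p))\<^sup>2 - (inner (x - p) v)\<^sup>2 / inner v v"
      using False by (simp add: t_def power2_eq_square)
    finally have "(inner (x - p) v)\<^sup>2 / inner v v \<le> 0"
      by simp
    then show ?thesis
      using False by (simp add: divide_le_0_iff not_le)
         (metis inner_gt_zero_iff less_le_not_le power2_less_eq_zero_iff)
  qed simp
  with pV show thesis
    by (rule that)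
qed

text \<open>
  The component \<open>w\<close> of a point outside \<open>ker f\<close> that is orthogonal to \<open>ker f\<close> represents \<open>f\<close> up to
  scaling, because \<open>y - (f y / f w) w\<close> lies in \<open>ker f\<close> for all \<open>y\<close>.
\<close>

lemma riesz_representation:
  fixes f :: "'a::{real_inner, complete_space} \<Rightarrow> real"
  assumes f: "bounded_linear f"
  obtains z where "\<And>x. f x = inner x z"
proof (cases "\<forall>x. f x = 0")
  case True
  then show thesis
    using that [of 0] by simp
next
  case False
  then obtain x where x: "f x \<noteq> 0"
    by blast
  interpret f: bounded_linear f by fact
  have "subspace {v. f v = 0}"
    by (auto simp: subspace_def f.add f.scale)
  moreover have "closed {v. f v = 0}"
    by (intro closed_Collect_eq continuous_intros f.continuous_on)
  ultimately obtain p where p: "f p = 0" "\<And>v. f v = 0 \<Longrightarrow> inner (x - p) v = 0"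
    using orthogonal_decomposition [of "{v. f v = 0}" x] by auto
  define w where "w = x - p"
  have fw: "f w \<noteq> 0"
    using x p by (simp add: w_def f.diff)
  then have w: "inner w w \<noteq> 0"
    by (auto simp: f.zero)
  have "f y = inner y ((f w / inner w w) *\<^sub>R w)" for y
  proof -
    have "f (y - (f y / f w) *\<^sub>R w) = 0"
      using fw by (simp add: f.diff f.scale)
    then have "inner w (y - (f y / f w) *\<^sub>R w) = 0"
      unfolding w_def by (rule p)
    then have "inner w y = (f y / f w) * inner w w"
      by (simp add: inner_diff_right)
    then show ?thesis
      using fw w by (simp add: inner_commute)
  qed
  then show thesis
    by (rule that)
qed

lemma cadjoint_eqI:
  assumes "\<And>x y. cinner (A x) y = cinner x (B y)"
  shows "cadjoint A = B"
  unfolding cadjoint_def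
proof (rule the_equality)
  show "\<forall>x y. cinner (A x) y = cinner x (B y)"
    using assms by blast
  show "C = B" if "\<forall>x y. cinner (A x) y = cinner x (C y)" for C
  proof (rule ext, rule cinner_eqI)
    show "cinner x (C y) = cinner x (B y)" for x y
      using that assms by metis
  qed
qed

text \<open>
  This makes \<^const>\<open>cadjoint\<close> usable: the definite description in its definition has a witness, which
  is found by representing \<open>x \<mapsto> \<langle>A x, y\<rangle>\<close>.
\<close>

lemma cinner_cadjoint:
  fixes A :: "'a::complex_hilbert \<Rightarrow> 'a"
  assumes A: "bounded_clinear A"
  shows "cinner (A x) y = cinner x (cadjoint A y)"
proof -
  interpret A: bounded_linear A
    using A by (rule bounded_clinear_bounded_linear)
  have "\<exists>z. \<forall>x. inner (A x) y = inner x z" for y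
    using riesz_representation [OF bounded_linear_compose
        [OF bounded_linear_inner_left A.bounded_linear_axioms], of y] by blast
  then obtain B where B: "inner (A x) y = inner x (B y)" for x y
    by metis
  have "cinner (A x) y = cinner x (B y)" for x y
  proof -
    \<comment> \<open>the imaginary part of the complex inner product is the real inner product with \<open>-\<i> x\<close>\<close>
    have Im: "Im (cinner u v) = inner ((-\<i>) *\<^sub>C u) v" for u v :: 'a
      unfolding inner_eq_Re_cinner cinner_scaleC_left by simp
    have "Re (cinner (A x) y) = Re (cinner x (B y))"
      using B [of x y] by (simp add: inner_eq_Re_cinner)
    moreover have "Im (cinner (A x) y) = Im (cinner x (B y))"
      unfolding Im using B [of "(-\<i>) *\<^sub>C x" y] unfolding bounded_clinear_scaleC [OF A] .
    ultimately show ?thesis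
      by (simp add: complex_eq_iff)
  qed
  then show ?thesis
    using cadjoint_eqI [of A B] by simp
qed

lemma self_adjoint_iff:
  fixes A :: "'a::complex_hilbert \<Rightarrow> 'a"
  shows "self_adjoint A \<longleftrightarrow> bounded_clinear A \<and> (\<forall>x y. cinner (A x) y = cinner x (A y))"
proof
  assume "self_adjoint A"
  then have A: "bounded_clinear A" and eq: "cadjoint A = A"
    by (simp_all add: self_adjoint_def)
  show "bounded_clinear A \<and> (\<forall>x y. cinner (A x) y = cinner x (A y))"
    using A cinner_cadjoint [OF A] by (simp add: eq)
next
  assume "bounded_clinear A \<and> (\<forall>x y. cinner (A x) y = cinner x (A y))"
  then show "self_adjoint A"
    using cadjoint_eqI [of A A] by (simp add: self_adjoint_def)
qed

section \<open>Polynomials of an operator\<close>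

text \<open>
  This is \<open>p(T) x\<close>. The Horner scheme is used instead of a sum of powers because its recursion
  follows the constructor \<^const>\<open>pCons\<close>, on which the inductions run.
\<close>

definition opoly :: "('a::complex_inner \<Rightarrow> 'a) \<Rightarrow> complex poly \<Rightarrow> 'a \<Rightarrow> 'a"
  where "opoly T p x = fold_coeffs (\<lambda>a y. a *\<^sub>C x + T y) p 0"

lemma opoly_0 [simp]: "opoly T 0 x = 0"
  by (simp add: opoly_def)

lemma opoly_pCons:
  assumes "bounded_clinear T"
  shows "opoly T (pCons a p) x = a *\<^sub>C x + T (opoly T p x)"
  by (cases "a = 0 \<and> p = 0") (auto simp: opoly_def bounded_clinear_zero [OF assms])

lemma opoly_add:
  assumes T: "bounded_clinear T"
  shows "opoly T (p + q) x = opoly T p x + opoly T q x"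
  by (induction p q rule: poly_induct2)
     (simp_all add: opoly_pCons [OF T] bounded_clinear_add [OF T] scaleC_add_left)

lemma opoly_smult:
  assumes T: "bounded_clinear T"
  shows "opoly T (smult c p) x = c *\<^sub>C opoly T p x"
  by (induction p)
     (simp_all add: opoly_pCons [OF T] bounded_clinear_scaleC [OF T] scaleC_add_right scaleC_scaleC)

lemma opoly_diff:
  assumes T: "bounded_clinear T"
  shows "opoly T (p - q) x = opoly T p x - opoly T q x"
  using opoly_add [OF T, of "p - q" q x] by (simp add: algebra_simps)

lemma opoly_mult:
  assumes T: "bounded_clinear T"
  shows "opoly T (p * q) x = opoly T p (opoly T q x)"
  by (induction p)
     (simp_all add: opoly_pCons [OF T] opoly_add [OF T] opoly_smult [OF T])

lemma bounded_clinear_opoly: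
  assumes T: "bounded_clinear T"
  shows "bounded_clinear (opoly T p)"
proof (induction p)
  case 0
  then show ?case
    using bounded_clinear_const_zero by (simp add: opoly_def)
next
  case (pCons a p)
  have "opoly T (pCons a p) = (\<lambda>x. a *\<^sub>C x + T (opoly T p x))"
    by (rule ext) (rule opoly_pCons [OF T])
  then show ?case
    by (simp add: bounded_clinear_plus bounded_clinear_scaleC_op bounded_clinear_ident
        bounded_clinear_compose T pCons.IH)
qed

lemma opoly_commute:
  assumes T: "bounded_clinear T" and A: "bounded_clinear A" and comm: "\<And>x. A (T x) = T (A x)"
  shows "A (opoly T p x) = opoly T p (A x)"
  by (induction p)
     (simp_all add: opoly_pCons [OF T] bounded_clinear_add [OF A] bounded_clinear_scaleC [OF A]
       bounded_clinear_zero [OF A] comm)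

lemma opoly_mem_invariant_subspace:
  assumes T: "bounded_clinear T" and V: "complex_vector.subspace V" and inv: "T ` V \<subseteq> V"
    and x: "x \<in> V"
  shows "opoly T p x \<in> V"
proof (induction p)
  case 0
  then show ?case
    using complex_vector.subspace_0 [OF V] by simp
next
  case (pCons a p)
  then show ?case
    unfolding opoly_pCons [OF T] using x inv
    by (intro complex_vector.subspace_add [OF V] complex_vector.subspace_scale [OF V]) auto
qed

text \<open>
  Polynomials with nonnegative coefficients behave well on contractions: the norm of \<open>p(T)\<close> is
  controlled by the single number \<open>p(1)\<close>, and \<open>p(T)\<close> is symmetric if \<open>T\<close> is.
\<close>

definition nonneg_coeffs :: "complex poly \<Rightarrow> bool"
  where "nonneg_coeffs p \<longleftrightarrow> (\<forall>i. 0 \<le> coeff p i)"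

lemma nonneg_coeffs_pCons [simp]: "nonneg_coeffs (pCons a p) \<longleftrightarrow> 0 \<le> a \<and> nonneg_coeffs p"
  unfolding nonneg_coeffs_def by (metis coeff_pCons_0 coeff_pCons_Suc not0_implies_Suc)

lemma nonneg_coeffs_0 [simp]: "nonneg_coeffs 0"
  by (simp add: nonneg_coeffs_def)

lemma nonneg_coeffs_add: "nonneg_coeffs p \<Longrightarrow> nonneg_coeffs q \<Longrightarrow> nonneg_coeffs (p + q)"
  by (simp add: nonneg_coeffs_def add_nonneg_nonneg)

lemma nonneg_coeffs_mult: "nonneg_coeffs p \<Longrightarrow> nonneg_coeffs q \<Longrightarrow> nonneg_coeffs (p * q)"
  unfolding nonneg_coeffs_def coeff_mult
  by (intro allI sum_nonneg mult_nonneg_nonneg) simp_all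

lemma nonneg_coeffs_half: "nonneg_coeffs p \<Longrightarrow> nonneg_coeffs (smult (1/2) p)"
  unfolding nonneg_coeffs_def by (auto simp: less_eq_complex_def)

lemma norm_opoly_le:
  assumes T: "bounded_clinear T" and contr: "\<And>x. norm (T x) \<le> norm x" and p: "nonneg_coeffs p"
  shows "norm (opoly T p x) \<le> Re (poly p 1) * norm x"
  using p
proof (induction p)
  case (pCons a p)
  have "norm (opoly T (pCons a p) x) \<le> norm (a *\<^sub>C x) + norm (T (opoly T p x))"
    unfolding opoly_pCons [OF T] by (rule norm_triangle_ineq)
  also have "norm (a *\<^sub>C x) = Re a * norm x"
    using pCons.prems by (simp add: norm_scaleC less_eq_complex_def cmod_eq_Re)
  also have "norm (T (opoly T p x)) \<le> Re (poly p 1) * norm x"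
    using pCons contr order_trans by fastforce
  finally show ?case
    by (simp add: algebra_simps)
qed simp

lemma opoly_symmetric:
  assumes T: "bounded_clinear T" and sym: "\<And>x y. cinner (T x) y = cinner x (T y)"
    and p: "nonneg_coeffs p"
  shows "cinner (opoly T p x) y = cinner x (opoly T p y)"
  using p
proof (induction p arbitrary: x y)
  case (pCons a p)
  have "cnj a = a"
    using pCons.prems by (simp add: complex_eq_iff less_eq_complex_def)
  moreover have "cinner (T (opoly T p x)) y = cinner x (T (opoly T p y))"
    using pCons by (simp add: sym opoly_commute [OF T T])
  ultimately show ?case
    by (simp add: opoly_pCons [OF T] cinner_add_left cinner_add_right cinner_scaleC_left
        cinner_scaleC_right)
qed simp

section \<open>The nonnegative square root of a nonnegative operator\<close>

text \<open>
  These polynomials approximate \<open>1 - sqrt (1 - X)\<close> by iteration, as a solution of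
  \<open>P = (X + P\<^sup>2) / 2\<close>. They and their increments have nonnegative coefficients, so their convergence at contractions reduces to
  the convergence of the bounded monotone sequence of their values at \<open>1\<close>.
\<close>

fun sqrt_poly :: "nat \<Rightarrow> complex poly"
  where
    "sqrt_poly 0 = 0"
  | "sqrt_poly (Suc n) = smult (1/2) ([:0, 1:] + sqrt_poly n * sqrt_poly n)"

lemma nonneg_coeffs_sqrt_poly: "nonneg_coeffs (sqrt_poly n)"
proof (induction n)
  case (Suc n)
  then show ?case
    unfolding sqrt_poly.simps
    by (intro nonneg_coeffs_half nonneg_coeffs_add nonneg_coeffs_mult) (auto simp: less_eq_complex_def)
qed simp

text \<open>The increment is \<open>p\<^sup>2 - q\<^sup>2 = (p + q) (p - q)\<close>, halved, where \<open>p - q\<close> is the previous increment.\<close>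

lemma nonneg_coeffs_sqrt_poly_step: "nonneg_coeffs (sqrt_poly (Suc n) - sqrt_poly n)"
proof (induction n)
  case 0
  then show ?case
    by (simp add: less_eq_complex_def)
next
  case (Suc n)
  define p q where "p = sqrt_poly (Suc n)" and "q = sqrt_poly n"
  have "sqrt_poly (Suc (Suc n)) = smult (1/2) ([:0, 1:] + p * p)"
    unfolding p_def by (rule sqrt_poly.simps)
  moreover have "sqrt_poly (Suc n) = smult (1/2) ([:0, 1:] + q * q)"
    unfolding q_def by (rule sqrt_poly.simps)
  ultimately have "sqrt_poly (Suc (Suc n)) - sqrt_poly (Suc n) =
      smult (1/2) ([:0, 1:] + p * p) - smult (1/2) ([:0, 1:] + q * q)"
    by (simp only:)
  also have "\<dots> = smult (1/2) ((p + q) * (p - q))"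
    by (simp only: smult_diff_right [symmetric]) (simp add: algebra_simps)
  also have "nonneg_coeffs \<dots>"
    using Suc unfolding p_def q_def
    by (intro nonneg_coeffs_half nonneg_coeffs_mult nonneg_coeffs_add nonneg_coeffs_sqrt_poly)
  finally show ?case .
qed

lemma nonneg_coeffs_sqrt_poly_diff:
  assumes "m \<le> n"
  shows "nonneg_coeffs (sqrt_poly n - sqrt_poly m)"
  using assms
proof (induction n rule: dec_induct)
  case (step n)
  have "sqrt_poly (Suc n) - sqrt_poly m = (sqrt_poly (Suc n) - sqrt_poly n) + (sqrt_poly n - sqrt_poly m)"
    by simp
  then show ?case
    using step.IH nonneg_coeffs_sqrt_poly_step nonneg_coeffs_add by metis
qed simp

lemma poly_1_nonneg: "nonneg_coeffs p \<Longrightarrow> 0 \<le> poly p 1"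
  by (induction p) (simp_all add: add_nonneg_nonneg)

lemma sqrt_poly_1_le: "poly (sqrt_poly n) 1 \<le> 1"
proof (induction n)
  case (Suc n)
  have "0 \<le> poly (sqrt_poly n) 1"
    by (intro poly_1_nonneg nonneg_coeffs_sqrt_poly)
  then have "poly (sqrt_poly n) 1 * poly (sqrt_poly n) 1 \<le> 1 * 1"
    using Suc by (intro mult_mono) (auto simp: less_eq_complex_def)
  then show ?case
    by (simp add: less_eq_complex_def)
qed (simp add: less_eq_complex_def)

lemma Cauchy_sqrt_poly: "Cauchy (\<lambda>n. Re (poly (sqrt_poly n) 1))"
proof (rule convergent_Cauchy, rule Bseq_mono_convergent)
  show "Bseq (\<lambda>n. Re (poly (sqrt_poly n) 1))"
  proof (rule BseqI' [where K = 1])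
    fix n
    show "norm (Re (poly (sqrt_poly n) 1)) \<le> 1"
      using sqrt_poly_1_le [of n] poly_1_nonneg [OF nonneg_coeffs_sqrt_poly [of n]]
      by (simp add: less_eq_complex_def)
  qed
  show "\<forall>m. \<forall>n\<ge>m. Re (poly (sqrt_poly m) 1) \<le> Re (poly (sqrt_poly n) 1)"
    using poly_1_nonneg [OF nonneg_coeffs_sqrt_poly_diff] by (simp add: less_eq_complex_def)
qed

text \<open>
  Evaluating the approximations at the contraction \<open>T\<close> gives the square root of \<open>1 - T\<close> in the form
  \<open>1 - P\<close>. As a limit of polynomials in \<open>T\<close>, the operator \<open>P\<close> commutes with all operators that
  commute with \<open>T\<close>.
\<close>

lemma sqrt_fixed_point:
  fixes T :: "'a::complex_hilbert \<Rightarrow> 'a"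
  assumes T: "bounded_clinear T" and sym: "\<And>x y. cinner (T x) y = cinner x (T y)"
    and contr: "\<And>x. norm (T x) \<le> norm x"
  obtains P where "bounded_clinear P" "\<And>x y. cinner (P x) y = cinner x (P y)"
    "\<And>x. norm (P x) \<le> norm x" "\<And>x. 2 *\<^sub>R P x = T x + P (P x)"
    "\<forall>A. bounded_clinear A \<longrightarrow> A \<circ> T = T \<circ> A \<longrightarrow> A \<circ> P = P \<circ> A"
proof -
  define Q where "Q n = opoly T (sqrt_poly n)" for n
  have Q_lin: "bounded_clinear (Q n)" for n
    unfolding Q_def by (rule bounded_clinear_opoly [OF T])
  have Q_norm: "norm (Q n x) \<le> norm x" for n x
  proof -
    have "norm (Q n x) \<le> Re (poly (sqrt_poly n) 1) * norm x"
      unfolding Q_def by (rule norm_opoly_le [OF T contr nonneg_coeffs_sqrt_poly])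
    also have "\<dots> \<le> 1 * norm x"
      using sqrt_poly_1_le [of n] by (intro mult_right_mono) (simp_all add: less_eq_complex_def)
    finally show ?thesis by simp
  qed
  have Q_diff: "norm (Q n x - Q m x) \<le> \<bar>Re (poly (sqrt_poly n) 1) - Re (poly (sqrt_poly m) 1)\<bar> * norm x"
    if "m \<le> n" for m n x
  proof -
    have "norm (Q n x - Q m x) \<le> Re (poly (sqrt_poly n - sqrt_poly m) 1) * norm x"
      unfolding Q_def opoly_diff [OF T, symmetric]
      by (rule norm_opoly_le [OF T contr nonneg_coeffs_sqrt_poly_diff [OF that]])
    also have "\<dots> \<le> \<bar>Re (poly (sqrt_poly n - sqrt_poly m) 1)\<bar> * norm x"
      by (intro mult_right_mono) auto
    finally show ?thesis by simp
  qed
  have Q_diff': "norm (Q n x - Q m x) \<le> \<bar>Re (poly (sqrt_poly n) 1) - Re (poly (sqrt_poly m) 1)\<bar> * norm x"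
    for m n x
    using Q_diff [of m n x] Q_diff [of n m x] by (cases "m \<le> n") (simp_all add: norm_minus_commute abs_minus_commute)
  have Cauchy: "Cauchy (\<lambda>n. Q n x)" for x
  proof (rule CauchyI)
    fix e :: real assume "e > 0"
    then have "e / (norm x + 1) > 0"
      by (simp add: add_nonneg_pos)
    from CauchyD [OF Cauchy_sqrt_poly this] obtain M where
      M: "\<And>m n. m \<ge> M \<Longrightarrow> n \<ge> M \<Longrightarrow>
        \<bar>Re (poly (sqrt_poly m) 1) - Re (poly (sqrt_poly n) 1)\<bar> < e / (norm x + 1)"
      by auto
    have "norm (Q m x - Q n x) < e" if "m \<ge> M" "n \<ge> M" for m n
    proof -
      have "norm (Q m x - Q n x) \<le> e / (norm x + 1) * norm x"
        using Q_diff' [where x = x and n = m and m = n] M [OF that]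
        by (meson less_imp_le mult_right_mono norm_ge_zero order_trans)
      also have "\<dots> < e"
        using \<open>e > 0\<close> by (simp add: divide_less_eq add_nonneg_pos)
      finally show ?thesis .
    qed
    then show "\<exists>M. \<forall>m\<ge>M. \<forall>n\<ge>M. norm (Q m x - Q n x) < e"
      by blast
  qed
  define P where "P x = lim (\<lambda>n. Q n x)" for x
  have lim: "(\<lambda>n. Q n x) \<longlonglongrightarrow> P x" for x
    unfolding P_def using Cauchy [of x] by (simp add: Cauchy_convergent_iff convergent_LIMSEQ_iff)
  have P_norm: "norm (P x) \<le> norm x" for x
    by (rule Lim_bounded [OF tendsto_norm [OF lim]]) (use Q_norm in blast)
  have P_commute: "A \<circ> P = P \<circ> A"
    if A: "bounded_clinear A" and comm: "A \<circ> T = T \<circ> A" for A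
  proof
    fix x
    have "(\<lambda>n. A (Q n x)) \<longlonglongrightarrow> A (P x)"
      by (intro bounded_linear.tendsto [OF bounded_clinear_bounded_linear [OF A]] lim)
    moreover have "A (Q n x) = Q n (A x)" for n
      unfolding Q_def by (rule opoly_commute [OF T A]) (use comm in \<open>simp add: fun_eq_iff\<close>)
    ultimately show "(A \<circ> P) x = (P \<circ> A) x"
      using lim [of "A x"] LIMSEQ_unique by auto
  qed
  have P_add: "P (x + y) = P x + P y" for x y
    using LIMSEQ_unique [OF lim [of "x + y"]] tendsto_add [OF lim [of x] lim [of y]]
    by (simp add: bounded_clinear_add [OF Q_lin])
  have P_scaleC: "P (c *\<^sub>C x) = c *\<^sub>C P x" for c x
    using LIMSEQ_unique [OF lim [of "c *\<^sub>C x"]]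
      bounded_linear.tendsto [OF bounded_linear_scaleC lim [of x], of c]
    by (simp add: bounded_clinear_scaleC [OF Q_lin])
  have P_lin: "bounded_clinear P"
  proof (rule bounded_clinearI)
    show "bounded_linear P"
      by (rule bounded_linear_intro [where K = 1])
         (simp_all add: P_add scaleR_scaleC P_scaleC P_norm)
  qed (rule P_scaleC)
  have inner_sym: "inner (P x) y = inner x (P y)" for x y
  proof -
    have "inner (Q n x) y = inner x (Q n y)" for n
      unfolding Q_def inner_eq_Re_cinner
      by (simp add: opoly_symmetric [OF T sym nonneg_coeffs_sqrt_poly])
    then show ?thesis
      using tendsto_inner [OF lim [of x] tendsto_const [of y]]
        tendsto_inner [OF tendsto_const [of x] lim [of y]] LIMSEQ_unique by auto
  qed
  have P_sym: "cinner (P x) y = cinner x (P y)" for x y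
    unfolding cinner_eq_Complex_inner P_scaleC [symmetric] inner_sym by (simp add: P_scaleC)
  \<comment> \<open>as the \<open>Q n\<close> are contractions, \<open>Q n (Q n x)\<close> has the same limit as \<open>Q n (P x)\<close>\<close>
  have square: "(\<lambda>n. Q n (Q n x)) \<longlonglongrightarrow> P (P x)" for x
  proof -
    have "(\<lambda>n. Q n (Q n x - P x)) \<longlonglongrightarrow> 0"
    proof (rule Lim_null_comparison)
      show "\<forall>\<^sub>F n in sequentially. norm (Q n (Q n x - P x)) \<le> norm (Q n x - P x)"
        using Q_norm by simp
      show "(\<lambda>n. norm (Q n x - P x)) \<longlonglongrightarrow> 0"
        using lim [of x] by (simp add: LIM_zero_iff tendsto_norm_zero_iff)
    qed
    from tendsto_add [OF this lim [of "P x"]] show ?thesis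
      by (simp add: bounded_clinear_diff [OF Q_lin])
  qed
  have P_fixed: "2 *\<^sub>R P x = T x + P (P x)" for x
  proof (rule LIMSEQ_unique)
    have "2 *\<^sub>R Q (Suc n) x = T x + Q n (Q n x)" for n
      by (simp add: Q_def opoly_smult [OF T] opoly_add [OF T] opoly_mult [OF T] opoly_pCons [OF T]
          bounded_clinear_zero [OF T] scaleR_scaleC scaleC_scaleC)
    then show "(\<lambda>n. 2 *\<^sub>R Q (Suc n) x) \<longlonglongrightarrow> T x + P (P x)"
      using tendsto_add [OF tendsto_const square] by simp
    show "(\<lambda>n. 2 *\<^sub>R Q (Suc n) x) \<longlonglongrightarrow> 2 *\<^sub>R P x"
      by (intro tendsto_scaleR tendsto_const LIMSEQ_Suc lim)
  qed
  show thesis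
    using P_commute by (intro that [OF P_lin P_sym P_norm P_fixed]) blast
qed

text \<open>The quadratic form of a symmetric operator is real, so its real part decides about its sign.\<close>

lemma nonneg_op_iff:
  fixes A :: "'a::complex_hilbert \<Rightarrow> 'a"
  shows "nonneg_op A \<longleftrightarrow>
    bounded_clinear A \<and> (\<forall>x y. cinner (A x) y = cinner x (A y)) \<and> (\<forall>x. 0 \<le> inner (A x) x)"
proof -
  have "0 \<le> cinner (A x) x \<longleftrightarrow> 0 \<le> inner (A x) x"
    if "\<forall>x y. cinner (A x) y = cinner x (A y)" for x
  proof -
    have "Im (cinner (A x) x) = 0"
      using that cinner_commute [of "A x" x] by (metis Reals_cnj_iff complex_is_Real_iff)
    then show ?thesis
      by (simp add: less_eq_complex_def inner_eq_Re_cinner)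
  qed
  then show ?thesis
    unfolding nonneg_op_def self_adjoint_iff by blast
qed

lemma nonneg_op_inner_commute:
  fixes A :: "'a::complex_hilbert \<Rightarrow> 'a"
  shows "nonneg_op A \<Longrightarrow> inner (A x) y = inner x (A y)"
  by (simp add: nonneg_op_iff inner_eq_Re_cinner)

text \<open>
  This follows by expanding \<open>0 \<le> \<langle>A u, u\<rangle>\<close> for \<open>u = K x - A x\<close> and bounding \<open>\<langle>A (A x), A x\<rangle>\<close> by
  \<open>K \<parallel>A x\<parallel>\<^sup>2\<close>.
\<close>

lemma nonneg_op_norm_square_le:
  fixes A :: "'a::complex_hilbert \<Rightarrow> 'a"
  assumes A: "nonneg_op A" and K: "K > 0" "\<And>x. norm (A x) \<le> K * norm x"
  shows "(norm (A x))\<^sup>2 \<le> K * inner (A x) x"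
proof -
  have lin: "bounded_linear A"
    using A by (simp add: nonneg_op_iff bounded_clinear_def)
  interpret A: bounded_linear A
    by (rule lin)
  define u where "u = K *\<^sub>R x - A x"
  have "inner (A (A x)) (A x) \<le> norm (A (A x)) * norm (A x)"
    by (rule norm_cauchy_schwarz)
  also have "\<dots> \<le> K * norm (A x) * norm (A x)"
    by (intro mult_right_mono K) simp
  finally have AA: "inner (A (A x)) (A x) \<le> K * (norm (A x))\<^sup>2"
    by (simp add: power2_eq_square)
  have "0 \<le> inner (A u) u"
    using A by (simp add: nonneg_op_iff)
  also have "inner (A u) u = K * (K * inner (A x) x) - K * inner (A x) (A x)
      - K * inner (A (A x)) x + inner (A (A x)) (A x)"
    by (simp add: u_def A.diff A.scaleR inner_diff_left inner_diff_right algebra_simps)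
  also have "inner (A (A x)) x = inner (A x) (A x)"
    by (rule nonneg_op_inner_commute [OF A])
  finally have "K * (norm (A x))\<^sup>2 \<le> K * (K * inner (A x) x)"
    using AA by (simp add: power2_norm_eq_inner)
  then show ?thesis
    using K by simp
qed

text \<open>So the kernel of a nonnegative operator is the zero set of its quadratic form.\<close>

lemma nonneg_op_eq_0:
  fixes A :: "'a::complex_hilbert \<Rightarrow> 'a"
  assumes A: "nonneg_op A" and x: "inner (A x) x = 0"
  shows "A x = 0"
proof -
  have "bounded_linear A"
    using A by (simp add: nonneg_op_iff bounded_clinear_def)
  from bounded_linear.pos_bounded [OF this] obtain K where
    "K > 0" "\<And>x. norm (A x) \<le> K * norm x"
    by (metis mult.commute)
  then show ?thesis
    using nonneg_op_norm_square_le [OF A, of K x] x by simp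
qed

text \<open>
  After scaling \<open>R\<close> to \<open>0 \<le> R \<le> 1\<close>, the operator \<open>T = 1 - R\<close> is a symmetric contraction, and the
  fixed point \<open>P = (T + P\<^sup>2) / 2\<close> gives \<open>(1 - P)\<^sup>2 = 1 - T = R\<close>.
\<close>

lemma nonneg_op_sqrt_exists:
  fixes R :: "'a::complex_hilbert \<Rightarrow> 'a"
  assumes R: "nonneg_op R"
  obtains S where "nonneg_op S" "\<And>x. S (S x) = R x"
    "\<forall>A. bounded_clinear A \<longrightarrow> A \<circ> R = R \<circ> A \<longrightarrow> A \<circ> S = S \<circ> A"
proof -
  have lin: "bounded_clinear R"
    using R by (simp add: nonneg_op_iff)
  from bounded_linear.pos_bounded [OF bounded_clinear_bounded_linear [OF this]] obtain K where
    K: "K > 0" "\<And>x. norm (R x) \<le> K * norm x"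
    by (metis mult.commute)
  define T where "T x = x - (1 / K) *\<^sub>R R x" for x
  have T_lin: "bounded_clinear T"
    unfolding T_def by (intro bounded_clinear_minus_op bounded_clinear_ident bounded_clinear_scaleR_op lin)
  have T_sym: "cinner (T x) y = cinner x (T y)" for x y
    using R by (simp add: T_def nonneg_op_iff cinner_diff_left cinner_diff_right scaleR_scaleC
        cinner_scaleC_left cinner_scaleC_right)
  have T_contr: "norm (T x) \<le> norm x" for x
  proof (rule power2_le_imp_le)
    have "(norm (T x))\<^sup>2 = (norm x)\<^sup>2 - 2 * (inner (R x) x / K) + (norm (R x))\<^sup>2 / K\<^sup>2"
      unfolding T_def power2_norm_eq_inner
      by (simp add: inner_diff_left inner_diff_right inner_commute power2_eq_square)
    also have "(norm (R x))\<^sup>2 / K\<^sup>2 \<le> (K * inner (R x) x) / K\<^sup>2"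
      by (intro divide_right_mono nonneg_op_norm_square_le R K) simp
    also have "(K * inner (R x) x) / K\<^sup>2 = inner (R x) x / K"
      using K by (simp add: power2_eq_square)
    finally have "(norm (T x))\<^sup>2 \<le> (norm x)\<^sup>2 - inner (R x) x / K"
      by simp
    moreover have "0 \<le> inner (R x) x / K"
      using R K by (simp add: nonneg_op_iff)
    ultimately show "(norm (T x))\<^sup>2 \<le> (norm x)\<^sup>2"
      by linarith
  qed simp
  obtain P where P: "bounded_clinear P" "\<And>x y. cinner (P x) y = cinner x (P y)"
    "\<And>x. norm (P x) \<le> norm x" "\<And>x. 2 *\<^sub>R P x = T x + P (P x)"
    "\<forall>A. bounded_clinear A \<longrightarrow> A \<circ> T = T \<circ> A \<longrightarrow> A \<circ> P = P \<circ> A"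
    by (rule sqrt_fixed_point [OF T_lin T_sym T_contr]) (rule that)
  define S where "S x = sqrt K *\<^sub>R (x - P x)" for x
  have S_lin: "bounded_clinear S"
    unfolding S_def by (intro bounded_clinear_minus_op bounded_clinear_ident bounded_clinear_scaleR_op P)
  have "cinner (S x) y = cinner x (S y)" for x y
    by (simp add: S_def P(2) cinner_diff_left cinner_diff_right scaleR_scaleC
        cinner_scaleC_left cinner_scaleC_right)
  moreover have "0 \<le> inner (S x) x" for x
  proof -
    have "inner (P x) x \<le> norm (P x) * norm x"
      by (rule norm_cauchy_schwarz)
    also have "\<dots> \<le> norm x * norm x"
      by (intro mult_right_mono P) simp
    finally show ?thesis
      using K by (simp add: S_def inner_diff_left power2_norm_eq_inner [symmetric] power2_eq_square)
  qed
  ultimately have S: "nonneg_op S"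
    using S_lin by (simp add: nonneg_op_iff)
  have "S (S x) = R x" for x
  proof -
    have "S (S x) = (sqrt K * sqrt K) *\<^sub>R (x - P x - P (x - P x))"
      by (simp only: S_def bounded_clinear_scaleR [OF P(1)] scaleR_diff_right [symmetric]
          scaleR_scaleR)
    also have "x - P x - P (x - P x) = x - (2 *\<^sub>R P x - P (P x))"
      by (simp add: bounded_clinear_diff [OF P(1)] scaleR_2)
    also have "\<dots> = (1 / K) *\<^sub>R R x"
      by (simp add: P(4) T_def)
    finally show ?thesis
      using K by simp
  qed
  moreover have "A \<circ> S = S \<circ> A"
    if A: "bounded_clinear A" and comm: "A \<circ> R = R \<circ> A" for A
  proof -
    have "A \<circ> T = T \<circ> A"
      using comm by (simp add: fun_eq_iff T_def bounded_clinear_diff [OF A]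
        bounded_clinear_scaleR [OF A])
    then have "A \<circ> P = P \<circ> A"
      using P(5) A by blast
    then show ?thesis
      by (simp add: fun_eq_iff S_def bounded_clinear_diff [OF A]
        bounded_clinear_scaleR [OF A])
  qed
  ultimately show thesis
    using that S by blast
qed

text \<open>
  Any nonnegative square root \<open>S'\<close> of \<open>R\<close> commutes with \<open>R\<close>, hence with the root \<open>S\<close> constructed
  before. So \<open>(S + S') (S - S') = S\<^sup>2 - S'\<^sup>2 = 0\<close>, and both nonnegative summands vanish on the range
  of \<open>S - S'\<close>.
\<close>

lemma nonneg_op_sqrt_unique:
  fixes R :: "'a::complex_hilbert \<Rightarrow> 'a"
  assumes S: "nonneg_op S" "\<And>x. S (S x) = R x"
    and comm: "\<forall>A. bounded_clinear A \<longrightarrow> A \<circ> R = R \<circ> A \<longrightarrow> A \<circ> S = S \<circ> A"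
    and S': "nonneg_op S'" "\<And>x. S' (S' x) = R x"
  shows "S' = S"
proof
  fix x
  have lin: "bounded_clinear S" "bounded_clinear S'"
    using S(1) S'(1) by (simp_all add: nonneg_op_iff)
  have S_S': "S' (S y) = S (S' y)" for y
  proof -
    have "S' \<circ> R = R \<circ> S'"
      by (simp add: fun_eq_iff S'(2) [symmetric])
    then have "S' \<circ> S = S \<circ> S'"
      using comm lin(2) by blast
    then show ?thesis
      by (simp add: fun_eq_iff)
  qed
  define y where "y = S x - S' x"
  have "S y + S' y = 0"
    by (simp add: y_def bounded_clinear_diff [OF lin(1)] bounded_clinear_diff [OF lin(2)] S(2) S'(2) S_S')
  then have "inner (S y) y + inner (S' y) y = 0"
    by (metis inner_add_left inner_zero_left)
  then have "inner (S y) y = 0" "inner (S' y) y = 0"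
    using S(1) S'(1) by (auto simp: nonneg_op_iff add_nonneg_eq_0_iff)
  then have "S y = 0" "S' y = 0"
    using nonneg_op_eq_0 S(1) S'(1) by blast+
  then have "inner y y = 0"
    using nonneg_op_inner_commute [OF S(1), of x y] nonneg_op_inner_commute [OF S'(1), of x y]
    by (simp add: y_def inner_diff_left)
  then show "S' x = S x"
    by (simp add: y_def)
qed

lemma op_sqrt:
  fixes R :: "'a::complex_hilbert \<Rightarrow> 'a"
  assumes R: "nonneg_op R"
  shows nonneg_op_op_sqrt: "nonneg_op (op_sqrt R)"
    and op_sqrt_op_sqrt: "op_sqrt R (op_sqrt R x) = R x"
proof -
  obtain S where S: "nonneg_op S" "\<And>x. S (S x) = R x"
    "\<forall>A. bounded_clinear A \<longrightarrow> A \<circ> R = R \<circ> A \<longrightarrow> A \<circ> S = S \<circ> A"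
    by (rule nonneg_op_sqrt_exists [OF R]) (rule that)
  have "op_sqrt R = S"
    unfolding op_sqrt_def
  proof (rule the_equality)
    show "nonneg_op S \<and> S \<circ> S = R"
      using S by auto
    show "S' = S" if "nonneg_op S' \<and> S' \<circ> S' = R" for S'
    proof -
      have "nonneg_op S'" "\<And>x. S' (S' x) = R x"
        using that by auto
      then show ?thesis
        by (intro nonneg_op_sqrt_unique [OF S])
    qed
  qed
  then show "nonneg_op (op_sqrt R)" "op_sqrt R (op_sqrt R x) = R x"
    using S by simp_all
qed

lemma cinner_sqrt_sqrt:
  fixes R :: "'a::complex_hilbert \<Rightarrow> 'a"
  assumes R: "nonneg_op R"
  shows "cinner (R x) x = complex_of_real ((norm (op_sqrt R x))\<^sup>2)"
proof -
  have "cinner (R x) x = cinner (op_sqrt R x) (op_sqrt R x)"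
    using nonneg_op_op_sqrt [OF R] unfolding nonneg_op_iff by (metis op_sqrt_op_sqrt [OF R])
  then show ?thesis
    by (simp add: cinner_self)
qed

lemma op_sqrt_eq_0_iff:
  fixes R :: "'a::complex_hilbert \<Rightarrow> 'a"
  assumes R: "nonneg_op R"
  shows "op_sqrt R x = 0 \<longleftrightarrow> R x = 0"
proof
  assume "op_sqrt R x = 0"
  then show "R x = 0"
    using nonneg_op_op_sqrt [OF R] op_sqrt_op_sqrt [OF R, of x]
    by (metis bounded_clinear_zero nonneg_op_iff)
next
  assume "R x = 0"
  then show "op_sqrt R x = 0"
    using cinner_sqrt_sqrt [OF R, of x] by simp
qed

section \<open>Eigenvectors in invariant subspaces of finite dimension\<close>

lemma opoly_sum:
  assumes T: "bounded_clinear T"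
  shows "opoly T (\<Sum>i\<in>I. p i) x = (\<Sum>i\<in>I. opoly T (p i) x)"
  by (induction I rule: infinite_finite_induct) (simp_all add: opoly_add [OF T])

lemma opoly_monom:
  assumes T: "bounded_clinear T"
  shows "opoly T (monom c i) x = c *\<^sub>C (T ^^ i) x"
  by (induction i)
     (simp_all add: monom_0 monom_Suc opoly_pCons [OF T] bounded_clinear_zero [OF T]
       bounded_clinear_scaleC [OF T])

text \<open>
  Otherwise the first \<open>card B + 1\<close> points of the orbit of \<open>v\<close> would be distinct and linearly
  independent, too many for the span of \<open>B\<close>.
\<close>

lemma annihilating_polynomial:
  assumes T: "bounded_clinear T" and B: "finite B" and V: "V \<subseteq> complex_vector.span B"
    and orbit: "\<And>i. (T ^^ i) v \<in> V"
  obtains p where "p \<noteq> 0" "opoly T p v = 0"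
proof (rule ccontr)
  assume "\<not> thesis"
  then have no: "p = 0" if "opoly T p v = 0" for p
    using that \<open>\<And>p. p \<noteq> 0 \<Longrightarrow> opoly T p v = 0 \<Longrightarrow> thesis\<close> by blast
  let ?I = "{..card B}"
  have inj: "inj_on (\<lambda>i. (T ^^ i) v) ?I"
  proof (rule inj_onI)
    fix i k assume "(T ^^ i) v = (T ^^ k) v"
    then have "opoly T (monom 1 i - monom 1 k) v = 0"
      by (simp add: opoly_diff [OF T] opoly_monom [OF T])
    from no [OF this] have "coeff (monom 1 i - monom 1 k :: complex poly) i = 0"
      by simp
    then show "i = k"
      by (auto split: if_splits)
  qed
  have "\<not> complex_vector.dependent ((\<lambda>i. (T ^^ i) v) ` ?I)"
  proof
    assume "complex_vector.dependent ((\<lambda>i. (T ^^ i) v) ` ?I)"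
    then obtain u k where k: "k \<le> card B" "u ((T ^^ k) v) \<noteq> 0"
      and u: "(\<Sum>w\<in>(\<lambda>i. (T ^^ i) v) ` ?I. u w *\<^sub>C w) = 0"
      by (auto simp: complex_vector.dependent_finite)
    define p where "p = (\<Sum>i\<in>?I. monom (u ((T ^^ i) v)) i)"
    have "opoly T p v = (\<Sum>i\<in>?I. u ((T ^^ i) v) *\<^sub>C (T ^^ i) v)"
      by (simp add: p_def opoly_sum [OF T] opoly_monom [OF T])
    also have "\<dots> = 0"
      using u by (simp add: sum.reindex [OF inj])
    finally have "p = 0"
      by (rule no)
    moreover have "coeff p k = u ((T ^^ k) v)"
      using k by (simp add: p_def coeff_sum)
    ultimately show False
      using k by simp
  qed
  moreover have "(\<lambda>i. (T ^^ i) v) ` ?I \<subseteq> complex_vector.span B"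
    using orbit V by blast
  ultimately have "card ((\<lambda>i. (T ^^ i) v) ` ?I) \<le> card B"
    using complex_vector.independent_span_bound [OF B] by blast
  then show False
    by (simp add: card_image [OF inj])
qed

text \<open>
  Take a nonzero polynomial \<open>p\<close> of least degree with \<open>p(T) v = 0\<close>. If \<open>z\<close> is a root of \<open>p\<close> and
  \<open>p = (X - z) q\<close>, then \<open>q(T) v\<close> is an eigenvector: it is nonzero because \<open>q\<close> has smaller degree.
\<close>

lemma eigenvector_in_invariant_subspace:
  assumes T: "bounded_clinear T" and B: "finite B" and VB: "V \<subseteq> complex_vector.span B"
    and V: "complex_vector.subspace V" and inv: "T ` V \<subseteq> V" and v: "v \<in> V" "v \<noteq> 0"
  obtains w where "w \<in> V" "ceigenvector T w"
proof -
  have "(T ^^ i) v \<in> V" for i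
    using v inv by (induction i) auto
  then obtain p0 where "p0 \<noteq> 0 \<and> opoly T p0 v = 0"
    using annihilating_polynomial [OF T B VB] by metis
  then obtain p where p: "p \<noteq> 0" "opoly T p v = 0"
    and least: "\<And>q. q \<noteq> 0 \<Longrightarrow> opoly T q v = 0 \<Longrightarrow> degree p \<le> degree q"
    using ex_has_least_nat [of "\<lambda>p. p \<noteq> 0 \<and> opoly T p v = 0" p0 degree] by blast
  have "degree p \<noteq> 0"
  proof
    assume "degree p = 0"
    then obtain a where "p = [:a:]"
      by (metis degree_eq_zeroE)
    with p v show False
      by (simp add: opoly_pCons [OF T] bounded_clinear_zero [OF T] complex_vector.scale_eq_0_iff)
  qed
  then obtain z where "poly p z = 0"
    using fundamental_theorem_of_algebra [of p] by (auto simp: constant_degree)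
  then obtain q where q: "p = [:- z, 1:] * q"
    by (metis poly_eq_0_iff_dvd dvdE)
  have q0: "q \<noteq> 0"
    using p q by auto
  have "degree p = Suc (degree q)"
    unfolding q using q0 by (subst degree_mult_eq) auto
  then have w0: "opoly T q v \<noteq> 0"
    using least [OF q0] by auto
  have "opoly T p v = T (opoly T q v) - z *\<^sub>C opoly T q v"
    unfolding q opoly_mult [OF T]
    by (simp add: opoly_pCons [OF T] bounded_clinear_zero [OF T] complex_vector.scale_minus_left)
  then have "T (opoly T q v) = z *\<^sub>C opoly T q v"
    using p by simp
  moreover have "opoly T q v \<in> V"
    by (rule opoly_mem_invariant_subspace [OF T V inv v(1)])
  ultimately show thesis
    using that w0 by (auto simp: ceigenvector_def)
qed

text \<open>
  The argument uses bases of \<open>U\<close> and \<open>W\<close> only, so the ambient space may have infinite dimension.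
\<close>

lemma cdim_psubset:
  assumes U: "complex_vector.subspace U" and UW: "U \<subset> W"
    and B: "finite B" and WB: "W \<subseteq> complex_vector.span B"
  shows "complex_vector.dim U < complex_vector.dim W"
proof -
  obtain C where C: "C \<subseteq> W" "\<not> complex_vector.dependent C" "W \<subseteq> complex_vector.span C"
    "card C = complex_vector.dim W"
    by (rule complex_vector.basis_exists)
  obtain D where D: "D \<subseteq> U" "\<not> complex_vector.dependent D" "U \<subseteq> complex_vector.span D"
    "card D = complex_vector.dim U"
    by (rule complex_vector.basis_exists)
  have "finite C"
    using complex_vector.independent_span_bound [OF B C(2)] C(1) WB by blast
  obtain x where x: "x \<in> W" "x \<notin> U"
    using UW by blast
  have "complex_vector.span D \<subseteq> U"
    by (rule complex_vector.span_minimal [OF D(1) U])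
  then have "x \<notin> complex_vector.span D"
    using x by blast
  then have "\<not> complex_vector.dependent (insert x D)"
    using D(2) by (rule complex_vector.independent_insertI)
  moreover have "insert x D \<subseteq> complex_vector.span C"
    using x UW D(1) C(3) by blast
  ultimately have "finite (insert x D) \<and> card (insert x D) \<le> card C"
    by (rule complex_vector.independent_span_bound [OF \<open>finite C\<close>])
  moreover have "x \<notin> D"
    using x D(1) by blast
  ultimately have "Suc (card D) \<le> card C"
    by (metis card_insert_disjoint finite_insert)
  then show ?thesis
    using C(4) D(4) by simp
qed

section \<open>The unobservable subspaces\<close>

text \<open>
  For the system \<open>x' = J x\<close> with output \<open>R x\<close>, these are the initial states that the output and its
  derivatives at time \<open>0\<close> up to order \<open>m\<close> cannot distinguish from \<open>0\<close>.
\<close>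

definition unobservable :: "('a::complex_inner \<Rightarrow> 'a) \<Rightarrow> ('a \<Rightarrow> 'a) \<Rightarrow> nat \<Rightarrow> 'a set"
  where "unobservable J R m = {x. \<forall>j\<le>m. R ((J ^^ j) x) = 0}"

lemma unobservable_antimono: "m \<le> m' \<Longrightarrow> unobservable J R m' \<subseteq> unobservable J R m"
  by (auto simp: unobservable_def)

lemma unobservable_0: "unobservable J R 0 = op_kernel R"
  by (simp add: unobservable_def op_kernel_def)

lemma subspace_unobservable:
  assumes J: "bounded_clinear J" and R: "bounded_clinear R"
  shows "complex_vector.subspace (unobservable J R m)"
proof -
  have lin: "bounded_clinear (\<lambda>x. R ((J ^^ j) x))" for j
    by (rule bounded_clinear_compose [OF R bounded_clinear_funpow [OF J]])
  show ?thesis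
    unfolding unobservable_def complex_vector.subspace_def
    using bounded_clinear_zero [OF lin] bounded_clinear_add [OF lin] bounded_clinear_scaleC [OF lin]
    by simp
qed

text \<open>If \<open>x\<close> satisfies one condition more, then \<open>J x\<close> satisfies the conditions up to \<open>m\<close>.\<close>

lemma unobservable_invariant:
  assumes "unobservable J R (Suc m) = unobservable J R m"
  shows "J ` unobservable J R m \<subseteq> unobservable J R m"
proof
  fix y assume "y \<in> J ` unobservable J R m"
  then obtain x where x: "x \<in> unobservable J R (Suc m)" and y: "y = J x"
    using assms by blast
  have "R ((J ^^ j) y) = 0" if "j \<le> m" for j
  proof -
    have "R ((J ^^ Suc j) x) = 0"
      using x that unfolding unobservable_def by blast
    then show ?thesis
      by (simp add: y funpow_swap1)
  qed
  then show "y \<in> unobservable J R m"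
    by (simp add: unobservable_def)
qed

text \<open>
  Where the decreasing chain is stationary at a nonzero subspace, this subspace is invariant and
  contains an eigenvector. Without eigenvectors in \<open>ker R\<close> the dimension therefore drops in each
  step until it is \<open>0\<close>, and it starts at \<open>dim (ker R)\<close>.
\<close>

lemma unobservable_eq_0:
  assumes J: "bounded_clinear J" and R: "bounded_clinear R"
    and fin: "finite_cdim (op_kernel R)" and B5: "B5 J R"
  shows "unobservable J R (complex_vector.dim (op_kernel R)) = {0}"
proof -
  let ?N = "unobservable J R"
  obtain B where B: "finite B" "complex_vector.span B = op_kernel R"
    using fin by (auto simp: finite_cdim_def)
  have sub: "?N m \<subseteq> complex_vector.span B" for m
    using unobservable_antimono [of 0 m J R] by (simp add: unobservable_0 B)
  have zero: "0 \<in> ?N m" for m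
    using complex_vector.subspace_0 [OF subspace_unobservable [OF J R]] .
  have strict: "?N (Suc m) \<subset> ?N m" if nonzero: "?N m \<noteq> {0}" for m
  proof -
    have "?N (Suc m) \<noteq> ?N m"
    proof
      assume eq: "?N (Suc m) = ?N m"
      obtain v where "v \<in> ?N m" "v \<noteq> 0"
        using nonzero zero [of m] by blast
      then obtain w where "w \<in> ?N m" "ceigenvector J w"
        by (rule eigenvector_in_invariant_subspace [OF J B(1) sub subspace_unobservable [OF J R]
            unobservable_invariant [OF eq]])
      then show False
        using B5 sub B by (auto simp: B5_def)
    qed
    then show ?thesis
      using unobservable_antimono [of m "Suc m" J R] by auto
  qed
  have bound: "complex_vector.dim (?N m) + m \<le> complex_vector.dim (op_kernel R)"
    if "\<And>k. k < m \<Longrightarrow> ?N k \<noteq> {0}" for m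
    using that
  proof (induction m)
    case 0
    then show ?case
      by (simp add: unobservable_0)
  next
    case (Suc m)
    have "complex_vector.dim (?N (Suc m)) < complex_vector.dim (?N m)"
      using Suc.prems
      by (intro cdim_psubset [OF subspace_unobservable [OF J R] strict B(1) sub]) simp
    moreover have "complex_vector.dim (?N m) + m \<le> complex_vector.dim (op_kernel R)"
      using Suc by simp
    ultimately show ?case
      by simp
  qed
  show ?thesis
  proof (rule ccontr)
    assume "?N (complex_vector.dim (op_kernel R)) \<noteq> {0}"
    then have "?N k \<noteq> {0}" if "k < Suc (complex_vector.dim (op_kernel R))" for k
      using unobservable_antimono [of k "complex_vector.dim (op_kernel R)" J R] that zero by fastforce
    then show False
      using bound [of "Suc (complex_vector.dim (op_kernel R))"] by simp
  qed
qed

lemma invariant_subset_unobservable: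
  assumes "V \<subseteq> op_kernel R" "J ` V \<subseteq> V"
  shows "V \<subseteq> unobservable J R m"
proof
  fix x assume "x \<in> V"
  then have "(J ^^ j) x \<in> V" for j
    using assms(2) by (induction j) auto
  then show "x \<in> unobservable J R m"
    using assms(1) by (auto simp: unobservable_def op_kernel_def)
qed

lemma B4_if_unobservable_eq_0:
  assumes "unobservable J R m = {0}"
  shows "B4 J R"
  unfolding B4_def
proof (intro allI impI)
  fix V assume V: "complex_vector.subspace V \<and> closed V \<and> V \<subseteq> op_kernel R \<and> J ` V \<subseteq> V"
  then have "V \<subseteq> {0}"
    using invariant_subset_unobservable assms by metis
  then show "V = {0}"
    using V complex_vector.subspace_0 by blast
qed

text \<open>
  Given an eigenvector in \<open>ker R\<close>, the intersection of its eigenspace with \<open>ker R\<close> contradicts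
  \<^const>\<open>B4\<close>. It is preferred to the span of the eigenvector because it is closed as an intersection
  of kernels.
\<close>

lemma B5_if_B4:
  assumes J: "bounded_clinear J" and R: "bounded_clinear R" and B4: "B4 J R"
  shows "B5 J R"
  unfolding B5_def
proof
  assume "\<exists>v. ceigenvector J v \<and> v \<in> op_kernel R"
  then obtain v c where v: "v \<noteq> 0" "J v = c *\<^sub>C v" "R v = 0"
    by (auto simp: ceigenvector_def op_kernel_def)
  define V where "V = {x. J x = c *\<^sub>C x} \<inter> {x. R x = 0}"
  have "complex_vector.subspace V"
    by (auto simp: V_def complex_vector.subspace_def bounded_clinear_zero [OF J]
        bounded_clinear_zero [OF R] bounded_clinear_add [OF J] bounded_clinear_add [OF R]
        bounded_clinear_scaleC [OF J] bounded_clinear_scaleC [OF R] scaleC_add_right scaleC_scaleC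
        mult.commute)
  moreover have "closed V"
    unfolding V_def using J R
    by (intro closed_Int closed_Collect_eq continuous_on_const bounded_linear_scaleC
        bounded_linear.continuous_on [OF _ continuous_on_id] bounded_clinear_bounded_linear)
  moreover have "V \<subseteq> op_kernel R" "J ` V \<subseteq> V"
    by (auto simp: V_def op_kernel_def bounded_clinear_scaleC [OF J] bounded_clinear_scaleC [OF R])
  ultimately have "V = {0}"
    using B4 by (simp add: B4_def)
  then show False
    using v by (auto simp: V_def)
qed

section \<open>Adjoint powers and the conditions for a fixed order\<close>

lemma cinner_funpow_cadjoint:
  fixes J :: "'a::complex_hilbert \<Rightarrow> 'a"
  assumes J: "bounded_clinear J"
  shows "cinner ((J ^^ j) x) y = cinner x ((cadjoint J ^^ j) y)"
proof (induction j arbitrary: y)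
  case (Suc j)
  have "cinner ((J ^^ Suc j) x) y = cinner ((J ^^ j) x) (cadjoint J y)"
    by (simp add: cinner_cadjoint [OF J])
  also have "\<dots> = cinner x ((cadjoint J ^^ j) (cadjoint J y))"
    by (rule Suc)
  finally show ?case
    by (simp add: funpow_swap1)
qed simp

lemma skew_adjoint_funpow:
  assumes J: "skew_adjoint J"
  shows "(cadjoint J ^^ j) x = (-1) ^ j *\<^sub>C (J ^^ j) x"
proof (induction j)
  case (Suc j)
  have "bounded_clinear J" "cadjoint J = (\<lambda>x. - J x)"
    using J by (simp_all add: skew_adjoint_def)
  then show ?case
    using Suc by (simp add: bounded_clinear_scaleC complex_vector.scale_minus_left)
qed simp

lemma B2_iff:
  fixes J R :: "'a::complex_hilbert \<Rightarrow> 'a"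
  shows "B2 J R m \<longleftrightarrow> (\<forall>x. (\<forall>j\<le>m. op_sqrt R ((cadjoint J ^^ j) x) = 0) \<longleftrightarrow> x = 0)"
  unfolding B2_def op_kernel_def set_eq_iff by (simp only: INT_iff mem_Collect_eq o_apply singleton_iff)
    (simp add: Ball_def)

lemma B2_iff_unobservable:
  fixes J R :: "'a::complex_hilbert \<Rightarrow> 'a"
  assumes J: "skew_adjoint J" and R: "nonneg_op R"
  shows "B2 J R m \<longleftrightarrow> unobservable J R m = {0}"
proof -
  have "R ((cadjoint J ^^ j) x) = (-1) ^ j *\<^sub>C R ((J ^^ j) x)" for j x
    using R by (simp add: skew_adjoint_funpow [OF J] nonneg_op_iff bounded_clinear_scaleC)
  then have "R ((cadjoint J ^^ j) x) = 0 \<longleftrightarrow> R ((J ^^ j) x) = 0" for j x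
    by (simp add: complex_vector.scale_eq_0_iff)
  then show ?thesis
    by (simp add: B2_iff op_sqrt_eq_0_iff [OF R] unobservable_def set_eq_iff)
qed

lemma subspace_closure_span: "subspace (closure (complex_vector.span G))"
proof (intro subspaceI)
  show "0 \<in> closure (complex_vector.span G)"
    using complex_vector.span_zero closure_subset by blast
next
  fix x y assume "x \<in> closure (complex_vector.span G)" "y \<in> closure (complex_vector.span G)"
  then obtain f g where "\<And>n. f n \<in> complex_vector.span G" "\<And>n. g n \<in> complex_vector.span G"
    "f \<longlonglongrightarrow> x" "g \<longlonglongrightarrow> y"
    unfolding closure_sequential by metis
  then have "(\<forall>n. f n + g n \<in> complex_vector.span G) \<and> (\<lambda>n. f n + g n) \<longlonglongrightarrow> x + y"
    by (simp add: complex_vector.span_add tendsto_add)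
  then show "x + y \<in> closure (complex_vector.span G)"
    unfolding closure_sequential by (rule exI [of _ "\<lambda>n. f n + g n"])
next
  fix r :: real and x assume "x \<in> closure (complex_vector.span G)"
  then obtain f where "\<And>n. f n \<in> complex_vector.span G" "f \<longlonglongrightarrow> x"
    unfolding closure_sequential by metis
  then have "(\<forall>n. r *\<^sub>R f n \<in> complex_vector.span G) \<and> (\<lambda>n. r *\<^sub>R f n) \<longlonglongrightarrow> r *\<^sub>R x"
    by (auto simp: scaleR_scaleC complex_vector.span_scale
        intro: bounded_linear.tendsto [OF bounded_linear_scaleC])
  then show "r *\<^sub>R x \<in> closure (complex_vector.span G)"
    unfolding closure_sequential by (rule exI [of _ "\<lambda>n. r *\<^sub>R f n"])
qed

text \<open>
  For the converse, the difference of a point and its projection to the closed span is orthogonal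
  to all generators.
\<close>

lemma closure_span_eq_UNIV_iff:
  fixes G :: "'a::complex_hilbert set"
  shows "closure (complex_vector.span G) = UNIV \<longleftrightarrow> (\<forall>z. (\<forall>g\<in>G. cinner g z = 0) \<longrightarrow> z = 0)"
proof
  assume dense: "closure (complex_vector.span G) = UNIV"
  show "\<forall>z. (\<forall>g\<in>G. cinner g z = 0) \<longrightarrow> z = 0"
  proof (intro allI impI)
    fix z assume z: "\<forall>g\<in>G. cinner g z = 0"
    have "complex_vector.subspace {w. cinner w z = 0}"
      by (simp add: complex_vector.subspace_def cinner_add_left cinner_scaleC_left)
    then have "complex_vector.span G \<subseteq> {w. cinner w z = 0}"
      using z by (intro complex_vector.span_minimal) auto
    then have "complex_vector.span G \<subseteq> {w. inner w z = 0}"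
      by (auto simp: inner_eq_Re_cinner)
    moreover have "closed {w. inner w z = 0}"
      by (intro closed_Collect_eq continuous_intros)
    ultimately have "closure (complex_vector.span G) \<subseteq> {w. inner w z = 0}"
      by (rule closure_minimal)
    then have "z \<in> {w. inner w z = 0}"
      using dense by blast
    then show "z = 0"
      by simp
  qed
next
  assume perp: "\<forall>z. (\<forall>g\<in>G. cinner g z = 0) \<longrightarrow> z = 0"
  have "x \<in> closure (complex_vector.span G)" for x
  proof -
    obtain p where p: "p \<in> closure (complex_vector.span G)"
      "\<And>v. v \<in> closure (complex_vector.span G) \<Longrightarrow> inner (x - p) v = 0"
      using orthogonal_decomposition [OF subspace_closure_span closed_closure] by metis
    \<comment> \<open>real orthogonality to all complex multiples of \<open>g\<close> is complex orthogonality to \<open>g\<close>\<close>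
    have orth: "inner (x - p) (c *\<^sub>C g) = 0" if "g \<in> G" for c g
    proof (rule p(2))
      have "c *\<^sub>C g \<in> complex_vector.span G"
        using that by (intro complex_vector.span_scale complex_vector.span_base)
      then show "c *\<^sub>C g \<in> closure (complex_vector.span G)"
        using closure_subset by blast
    qed
    have "cinner g (x - p) = 0" if "g \<in> G" for g
    proof -
      have "cinner (x - p) g = 0"
        using orth [OF that, of 1] orth [OF that, of \<i>] by (simp add: cinner_eq_Complex_inner zero_complex.code)
      then show ?thesis
        using cinner_commute [of g "x - p"] by simp
    qed
    then have "x - p = 0"
      using perp by blast
    then show ?thesis
      using p(1) by simp
  qed
  then show "closure (complex_vector.span G) = UNIV"
    by blast
qed

lemma op_sqrt_cadjoint_0:
  fixes J R :: "'a::complex_hilbert \<Rightarrow> 'a"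
  assumes J: "bounded_clinear J" and R: "nonneg_op R"
  shows "op_sqrt R ((cadjoint J ^^ j) 0) = 0"
proof -
  have "cinner x ((cadjoint J ^^ j) 0) = 0" for x
    by (simp add: cinner_funpow_cadjoint [OF J, symmetric])
  then have "(cadjoint J ^^ j) 0 = 0"
    using cinner_all_eq_0_iff by blast
  then show ?thesis
    using nonneg_op_op_sqrt [OF R] by (simp add: nonneg_op_iff bounded_clinear_zero)
qed

text \<open>
  \<open>z\<close> is orthogonal to the range of \<open>J\<^sup>j sqrt R\<close> if and only if \<open>sqrt R (J\<^sup>*)\<^sup>j z = 0\<close>, so the density
  criterion applies.
\<close>

lemma B1_iff_B2:
  fixes J R :: "'a::complex_hilbert \<Rightarrow> 'a"
  assumes J: "bounded_clinear J" and R: "nonneg_op R"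
  shows "B1 J R m \<longleftrightarrow> B2 J R m"
proof -
  let ?S = "op_sqrt R"
  have S: "bounded_clinear ?S" "cinner (?S x) y = cinner x (?S y)" for x y
    using nonneg_op_op_sqrt [OF R] by (auto simp: nonneg_op_iff)
  have adj: "cinner ((J ^^ j) (?S x)) z = cinner x (?S ((cadjoint J ^^ j) z))" for j x z
    by (simp add: cinner_funpow_cadjoint [OF J] S)
  have "(\<forall>x. cinner ((J ^^ j) (?S x)) z = 0) \<longleftrightarrow> ?S ((cadjoint J ^^ j) z) = 0" for j z
    unfolding adj by (rule cinner_all_eq_0_iff)
  then have "(\<forall>g\<in>(\<Union>j\<in>{0..m}. range ((J ^^ j) \<circ> ?S)). cinner g z = 0) \<longleftrightarrow>
      (\<forall>j\<le>m. ?S ((cadjoint J ^^ j) z) = 0)" for z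
    by auto
  moreover have "?S ((cadjoint J ^^ j) 0) = 0" for j
    by (rule op_sqrt_cadjoint_0 [OF J R])
  ultimately show ?thesis
    unfolding B1_def closure_span_eq_UNIV_iff B2_iff by auto
qed

lemma cinner_conjugated:
  fixes J R :: "'a::complex_hilbert \<Rightarrow> 'a"
  assumes J: "bounded_clinear J" and R: "nonneg_op R"
  shows "cinner (((J ^^ j) \<circ> R \<circ> (cadjoint J ^^ j)) x) x =
    complex_of_real ((norm (op_sqrt R ((cadjoint J ^^ j) x)))\<^sup>2)"
  by (simp only: o_apply cinner_funpow_cadjoint [OF J] cinner_sqrt_sqrt [OF R])

lemma B2_iff_B3:
  fixes J R :: "'a::complex_hilbert \<Rightarrow> 'a"
  assumes lin: "bounded_clinear J" and R: "nonneg_op R"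
  shows "B2 J R m \<longleftrightarrow> B3 J R m"
proof -
  have "B3 J R m \<longleftrightarrow> (\<forall>x. x \<noteq> 0 \<longrightarrow> (\<exists>j\<le>m. op_sqrt R ((cadjoint J ^^ j) x) \<noteq> 0))"
    unfolding B3_def cinner_conjugated [OF lin R] by (simp add: less_complex_def Bex_def)
  also have "\<dots> \<longleftrightarrow> (\<forall>x. (\<forall>j\<le>m. op_sqrt R ((cadjoint J ^^ j) x) = 0) \<longleftrightarrow> x = 0)"
    using op_sqrt_cadjoint_0 [OF lin R] by auto
  finally show ?thesis
    by (simp add: B2_iff)
qed

lemma bounded_clinear_cadjoint:
  fixes J :: "'a::complex_hilbert \<Rightarrow> 'a"
  assumes J: "skew_adjoint J"
  shows "bounded_clinear (cadjoint J)"
  using J by (simp add: skew_adjoint_def bounded_clinear_uminus)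

lemma B3_iff_B3_sum:
  fixes J R :: "'a::complex_hilbert \<Rightarrow> 'a"
  assumes J: "skew_adjoint J" and R: "nonneg_op R"
  shows "B3 J R m \<longleftrightarrow> B3_sum J R m"
proof -
  have lin: "bounded_clinear J"
    using J by (simp add: skew_adjoint_def)
  define K where "K j x = ((J ^^ j) \<circ> R \<circ> (cadjoint J ^^ j)) x" for j x
  have K_lin: "bounded_clinear (K j)" for j
  proof -
    have "bounded_clinear R"
      using R by (simp add: nonneg_op_iff)
    then have "bounded_clinear (\<lambda>x. R ((cadjoint J ^^ j) x))"
      by (rule bounded_clinear_compose [OF _ bounded_clinear_funpow [OF bounded_clinear_cadjoint [OF J]]])
    then show ?thesis
      unfolding K_def o_apply by (rule bounded_clinear_compose [OF bounded_clinear_funpow [OF lin]])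
  qed
  have "cinner (K j x) y = cinner x (K j y)" for j x y
  proof -
    have "cinner x (K j y) = cnj (cinner ((J ^^ j) (R ((cadjoint J ^^ j) y))) x)"
      unfolding K_def o_apply by (rule cinner_commute)
    also have "\<dots> = cinner ((cadjoint J ^^ j) x) (R ((cadjoint J ^^ j) y))"
      unfolding cinner_funpow_cadjoint [OF lin] by (rule cinner_commute [symmetric])
    also have "\<dots> = cinner (R ((cadjoint J ^^ j) x)) ((cadjoint J ^^ j) y)"
      using R by (simp add: nonneg_op_iff)
    also have "\<dots> = cinner (K j x) y"
      unfolding K_def o_apply cinner_funpow_cadjoint [OF lin] ..
    finally show ?thesis ..
  qed
  then have "self_adjoint (\<lambda>x. \<Sum>j=0..m. K j x)"
    unfolding self_adjoint_iff
    by (simp add: bounded_clinear_sum K_lin cinner_sum_left cinner_sum_right)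
  moreover have "0 < cinner (\<Sum>j=0..m. K j x) x \<longleftrightarrow> (\<exists>j\<in>{0..m}. 0 < cinner (K j x) x)" for x
  proof -
    define r where "r j = (norm (op_sqrt R ((cadjoint J ^^ j) x)))\<^sup>2" for j
    have r: "cinner (K j x) x = complex_of_real (r j)" for j
      unfolding K_def r_def by (rule cinner_conjugated [OF lin R])
    have nonneg: "r j \<ge> 0" for j
      by (simp add: r_def)
    have "0 < (\<Sum>j=0..m. r j) \<longleftrightarrow> (\<exists>j\<in>{0..m}. 0 < r j)"
      using sum_nonneg_eq_0_iff [of "{0..m}" r] sum_nonneg [of "{0..m}" r] nonneg
      by (metis finite_atLeastAtMost less_le)
    then show ?thesis
      by (simp add: cinner_sum_left r less_complex_def)
  qed
  ultimately show ?thesis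
    unfolding B3_def B3_sum_def pos_op_def K_def by simp
qed

theorem proposition2p1:
  fixes J R :: "'a::complex_hilbert \<Rightarrow> 'a"
  assumes "separable_space (euclidean :: 'a topology)"
    and "skew_adjoint J"
    and "self_adjoint R" and "nonneg_op R"
    and "finite_cdim (op_kernel R)"
  shows "((\<exists>m. B1 J R m) \<longleftrightarrow> (\<exists>m. B2 J R m)) \<and>
    ((\<exists>m. B2 J R m) \<longleftrightarrow> (\<exists>m. B3 J R m)) \<and>
    ((\<exists>m. B3 J R m) \<longleftrightarrow> B4 J R) \<and>
    (B4 J R \<longleftrightarrow> B5 J R) \<and>
    (\<forall>m. (B1 J R m \<longleftrightarrow> B2 J R m) \<and> (B2 J R m \<longleftrightarrow> B3 J R m) \<and> (B3 J R m \<longleftrightarrow> B3_sum J R m)) \<and>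
    (\<forall>m m'. m < m' \<longrightarrow>
      (B1 J R m \<longrightarrow> B1 J R m') \<and> (B2 J R m \<longrightarrow> B2 J R m') \<and> (B3 J R m \<longrightarrow> B3 J R m')) \<and>
    ((\<exists>m. B1 J R m \<and> B2 J R m \<and> B3 J R m) \<longrightarrow>
      (LEAST m. B1 J R m \<and> B2 J R m \<and> B3 J R m) \<le> complex_vector.dim (op_kernel R))"
proof -
  let ?d = "complex_vector.dim (op_kernel R)"
  have J: "bounded_clinear J" and R: "bounded_clinear R"
    using assms by (simp_all add: skew_adjoint_def self_adjoint_def)
  have B1: "B1 J R m \<longleftrightarrow> B2 J R m" for m
    by (rule B1_iff_B2 [OF J \<open>nonneg_op R\<close>])
  have B3: "B3 J R m \<longleftrightarrow> B2 J R m" for m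
    by (rule B2_iff_B3 [OF J \<open>nonneg_op R\<close>, symmetric])
  have B3_sum: "B3_sum J R m \<longleftrightarrow> B2 J R m" for m
    using B3_iff_B3_sum [OF \<open>skew_adjoint J\<close> \<open>nonneg_op R\<close>] B3 by simp
  have B2: "B2 J R m \<longleftrightarrow> unobservable J R m = {0}" for m
    by (rule B2_iff_unobservable [OF \<open>skew_adjoint J\<close> \<open>nonneg_op R\<close>])
  have "B2 J R m \<Longrightarrow> B4 J R" for m
    unfolding B2 by (rule B4_if_unobservable_eq_0)
  moreover have B4: "B4 J R \<Longrightarrow> B5 J R"
    by (rule B5_if_B4 [OF J R])
  moreover have B5: "B5 J R \<Longrightarrow> B2 J R ?d"
    unfolding B2 by (rule unobservable_eq_0 [OF J R \<open>finite_cdim (op_kernel R)\<close>])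
  ultimately have B2_d: "(\<exists>m. B2 J R m) \<longleftrightarrow> B2 J R ?d" "B4 J R \<longleftrightarrow> B2 J R ?d" "B5 J R \<longleftrightarrow> B2 J R ?d"
    by blast+
  have mono: "B2 J R m'" if "B2 J R m" "m < m'" for m m'
  proof -
    have "unobservable J R m' \<subseteq> {0}"
      using that unobservable_antimono [of m m' J R] by (simp add: B2)
    moreover have "0 \<in> unobservable J R m'"
      by (rule complex_vector.subspace_0 [OF subspace_unobservable [OF J R]])
    ultimately show ?thesis
      by (auto simp: B2)
  qed
  have "(LEAST m. B2 J R m) \<le> ?d" if "\<exists>m. B2 J R m"
    using that B2_d(1) by (intro Least_le) simp
  then show ?thesis
    unfolding B1 B3 B3_sum using B2_d mono by auto
qed

end
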